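(* Let $0\le v_1<\cdots<v_n$ be real numbers, $v=(v_1,\ldots,v_n)$, let $J\subset\{1,\ldots,n\}$ with $|J|\le n-4$, let $a_j\ne 0$ be real for $j\in J$, and let $\alpha\in\mathbb{R}$. Suppose that the inequality $$\sum_{j\in J}a_jx_j\ge\alpha$$ is facet-defining for $H_n(v)$. Let $J_+=\{j\in J: a_j>0\}$ and $J_-=\{j\in J: a_j<0\}$. Then the inequality is satisfied by all $J$-circuits that are undominated with respect to $(J_+,J_-)$, and at least $|J|$ affinely independent $J$-circuits satisfy $\sum_{j\in J}a_jx_j=\alpha$.
   Context: A point $x=(x_1,\ldots,x_n)\in\{v_1,\ldots,v_n\}^n$ is a circuit if the map $\sigma$ on $\{1,\ldots,n\}$ defined by $x_i=v_{\sigma(i)}$ is a permutation consisting of a single $n$-cycle. The hamiltonian circuit polytope $H_n(v)\subset\mathbb{R}^n$ is the convex hull of all circuits. An inequality is facet-defining for $H_n(v)$ if it is satisfied by all points of $H_n(v)$ and the set of points of $H_n(v)$ satisfying it at equality is a face of dimension $\dim H_n(v)-1$. For $J\subset\{1,\ldots,n\}$, a $J$-circuit is a tuple $x(J)=(x_j)_{j\in J}$ of pairwise distinct values from $\{v_1,\ldots,v_n\}$ that creates no cycle: there are no $k\ge 1$ and distinct $i_1,\ldots,i_k\in J$ with $x_{i_t}=v_{i_{t+1}}$ for $t=1,\ldots,k-1$ and $x_{i_k}=v_{i_1}$. For a partition $(J_+,J_-)$ of $J$ (parts may be empty), $x(J)$ dominates $y(J)$ with respect to $(J_+,J_-)$ if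 $x_j\le y_j$ for all $j\in J_+$ and $x_j\ge y_j$ for all $j\in J_-$. A $J$-circuit is undominated with respect to $(J_+,J_-)$ if no other $J$-circuit dominates it with respect to $(J_+,J_-)$. *)

theory Defs
  imports "HOL-Analysis.Analysis" "HOL-Combinatorics.Orbits"
begin

text \<open>
  The index set \<open>{1,\<dots>,n}\<close> is rendered as an arbitrary finite linearly ordered type \<open>'n\<close>,
  with \<open>n = CARD('n)\<close>; a sequence \<open>v\<^sub>1 < \<dots> < v\<^sub>n\<close> is a strictly monotone \<open>v :: 'n \<Rightarrow> real\<close>.
\<close>

definition circuit :: "('n::finite \<Rightarrow> real) \<Rightarrow> real ^ 'n \<Rightarrow> bool" where
  "circuit v x \<longleftrightarrow>
     (\<exists>\<sigma>. (\<forall>i. x $ i = v (\<sigma> i)) \<and> \<sigma> permutes UNIV \<and> cyclic_on \<sigma> UNIV)"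

definition hamiltonian_circuit_polytope :: "('n::finite \<Rightarrow> real) \<Rightarrow> (real ^ 'n) set" where
  "hamiltonian_circuit_polytope v = convex hull {x. circuit v x}"

text \<open>The inequality \<open>f x \<ge> \<alpha>\<close>, for a linear functional \<open>f\<close>, is facet-defining for \<open>P\<close>.\<close>

definition facet_defining :: "'a::euclidean_space set \<Rightarrow> ('a \<Rightarrow> real) \<Rightarrow> real \<Rightarrow> bool" where
  "facet_defining P f \<alpha> \<longleftrightarrow>
     (\<forall>x\<in>P. f x \<ge> \<alpha>) \<and>
     {x \<in> P. f x = \<alpha>} face_of P \<and>
     aff_dim {x \<in> P. f x = \<alpha>} = aff_dim P - 1"

text \<open>
  A tuple \<open>(x\<^sub>j)\<close> indexed by \<open>J\<close> is a vector whose coordinates outside \<open>J\<close> are \<open>0\<close>. Under this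
  identification of \<open>\<real>\<^sup>J\<close> with a coordinate subspace, equality and affine independence of
  tuples are equality and affine independence of the vectors.
\<close>

definition J_tuple :: "'n::finite set \<Rightarrow> real ^ 'n \<Rightarrow> bool" where
  "J_tuple J x \<longleftrightarrow> (\<forall>j. j \<notin> J \<longrightarrow> x $ j = 0)"

definition creates_cycle :: "('n::finite \<Rightarrow> real) \<Rightarrow> 'n set \<Rightarrow> real ^ 'n \<Rightarrow> bool" where
  "creates_cycle v J x \<longleftrightarrow>
     (\<exists>(k::nat) (i :: nat \<Rightarrow> 'n). k \<ge> 1 \<and> inj_on i {1..k} \<and> i ` {1..k} \<subseteq> J \<and>
        (\<forall>t\<in>{1..<k}. x $ i t = v (i (t + 1))) \<and> x $ i k = v (i 1))"

definition J_circuit :: "('n::finite \<Rightarrow> real) \<Rightarrow> 'n set \<Rightarrow> real ^ 'n \<Rightarrow> bool" where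
  "J_circuit v J x \<longleftrightarrow>
     J_tuple J x \<and> (\<forall>j\<in>J. x $ j \<in> range v) \<and> inj_on (\<lambda>j. x $ j) J \<and> \<not> creates_cycle v J x"

definition dominates :: "'n::finite set \<Rightarrow> 'n set \<Rightarrow> real ^ 'n \<Rightarrow> real ^ 'n \<Rightarrow> bool" where
  "dominates Jp Jm x y \<longleftrightarrow> (\<forall>j\<in>Jp. x $ j \<le> y $ j) \<and> (\<forall>j\<in>Jm. x $ j \<ge> y $ j)"

text \<open>Here \<open>(Jp, Jm)\<close> is meant to be a partition of \<open>J\<close>, possibly with empty parts.\<close>

definition undominated_J_circuit ::
    "('n::finite \<Rightarrow> real) \<Rightarrow> 'n set \<Rightarrow> 'n set \<Rightarrow> 'n set \<Rightarrow> real ^ 'n \<Rightarrow> bool" where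
  "undominated_J_circuit v J Jp Jm x \<longleftrightarrow>
     J_circuit v J x \<and> \<not> (\<exists>y. J_circuit v J y \<and> y \<noteq> x \<and> dominates Jp Jm y x)"

end

theory Submission
  imports Defs
begin

text \<open>
  Two facts carry the argument.

  First, \<open>J\<close>-circuits are precisely the restrictions of circuits to \<open>J\<close> when \<open>J\<close> is a proper subset of
  the indices. An injective partial map without cycles is a disjoint union of paths, and paths can
  be joined one after the other into a single cycle (\<open>extend_to_full_cycle\<close>,
  \<open>J_circuit_extends_to_circuit\<close>); conversely a full cycle contains no shorter one
  (\<open>circuit_restricts_to_J_circuit\<close>). As the inequality only reads the coordinates in \<open>J\<close>, it holds
  for every \<open>J\<close>-circuit because it holds for every circuit, and undominated \<open>J\<close>-circuits are a
  special case.

  Secondly, there are enough circuits on the facet. If \<open>J\<close> is empty there is nothing to show;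
  otherwise \<open>n \<ge> 5\<close>, and the polytope has dimension at least \<open>n - 1\<close> (\<open>aff_dim_circuits_ge\<close>): a linear
  functional that is constant on all circuits must have equal coefficients. This comes from swapping
  two neighbours on a cycle, which changes only three coordinates
  (\<open>exchange_equation\<close>, \<open>constant_on_circuits_imp_constant_coeffs\<close>). Hence the circuits on the facet
  have affine dimension at least \<open>n - 2\<close>. They all lie in the hyperplane where the coordinate sum is
  \<open>\<Sum>v\<^sub>i\<close>, and the directions in this hyperplane that vanish on \<open>J\<close> form a space of dimension
  \<open>n - |J| - 1\<close>. So projecting to \<open>J\<close> leaves affine dimension at least \<open>|J| - 1\<close>
  (\<open>aff_dim_coord_restrict_ge\<close>), and an affine basis chosen among the projected circuits gives the
  required \<open>J\<close>-circuits.
\<close>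

section \<open>Extending a partial map without cycles to a full cycle\<close>

lemma card_complement:
  fixes A :: "'a::finite set"
  shows "card (- A) = CARD('a) - card A"
  by (simp add: Compl_eq_Diff_UNIV card_Diff_subset)

text \<open>
  The graph of \<open>\<sigma>\<close> restricted to \<open>J\<close>, as a relation, so that "\<open>\<sigma>\<close> creates no cycle on \<open>J\<close>" becomes
  acyclicity of a relation.
\<close>

definition arcs :: "'a set \<Rightarrow> ('a \<Rightarrow> 'a) \<Rightarrow> ('a \<times> 'a) set" where
  "arcs J \<sigma> = {(j, \<sigma> j) | j. j \<in> J}"

lemma arcs_insert_upd:
  assumes "j \<notin> J"
  shows "arcs (insert j J) (\<sigma>(j := w)) = insert (j, w) (arcs J \<sigma>)"
  using assms by (auto simp: arcs_def)

lemma single_valued_converse_arcs: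
  assumes "inj_on \<sigma> J"
  shows "single_valued ((arcs J \<sigma>)\<inverse>)"
  using assms by (auto simp: arcs_def single_valued_def inj_on_def)

lemma finite_arcs:
  fixes \<sigma> :: "'a::finite \<Rightarrow> 'a"
  shows "finite (arcs J \<sigma>)"
  by (rule finite_subset[OF subset_UNIV]) simp

lemma arcs_trancl_orbit: "(x, y) \<in> (arcs J \<sigma>)\<^sup>+ \<Longrightarrow> y \<in> orbit \<sigma> x"
  by (induction rule: trancl_induct) (auto simp: arcs_def intro: orbit.intros)

text \<open>
  Two paths of an injective partial map that end in the same point are nested, so at most one path
  start leads to \<open>j\<close>. If at least two values are not taken, one of them starts a path that
  avoids \<open>j\<close>; when \<open>j\<close> has no outgoing arc yet, sending it there closes no cycle.
\<close>

lemma ex_source_not_reaching: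
  fixes \<sigma> :: "'a::finite \<Rightarrow> 'a"
  assumes inj: "inj_on \<sigma> J" and card: "card J + 2 \<le> CARD('a)"
  obtains w where "w \<notin> \<sigma> ` J" "(w, j) \<notin> (arcs J \<sigma>)\<^sup>*"
proof -
  have "card (\<sigma> ` J) = card J"
    by (rule card_image[OF inj])
  then have "2 \<le> card (- \<sigma> ` J)"
    using card by (simp add: card_complement)
  then obtain T where "T \<subseteq> - \<sigma> ` J" "card T = 2"
    by (meson obtain_subset_with_card_n)
  then obtain w1 w2 where w: "w1 \<notin> \<sigma> ` J" "w2 \<notin> \<sigma> ` J" "w1 \<noteq> w2"
    by (auto simp: card_2_iff)
  have no_entry: "y = w" if "(y, w) \<in> (arcs J \<sigma>)\<^sup>*" "w \<notin> \<sigma> ` J" for y w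
    using that(1) by cases (use that(2) in \<open>auto simp: arcs_def\<close>)
  have "\<not> ((w1, j) \<in> (arcs J \<sigma>)\<^sup>* \<and> (w2, j) \<in> (arcs J \<sigma>)\<^sup>*)"
  proof
    assume "(w1, j) \<in> (arcs J \<sigma>)\<^sup>* \<and> (w2, j) \<in> (arcs J \<sigma>)\<^sup>*"
    then have "(j, w1) \<in> ((arcs J \<sigma>)\<inverse>)\<^sup>*" "(j, w2) \<in> ((arcs J \<sigma>)\<inverse>)\<^sup>*"
      by (simp_all add: rtrancl_converse)
    from single_valued_confluent[OF single_valued_converse_arcs[OF inj] this]
    have "(w2, w1) \<in> (arcs J \<sigma>)\<^sup>* \<or> (w1, w2) \<in> (arcs J \<sigma>)\<^sup>*"
      by (simp add: rtrancl_converse)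
    with w no_entry show False by metis
  qed
  with w that show thesis by blast
qed

text \<open>
  An injective acyclic map that is undefined only at \<open>j\<close> is one path: going backwards from any point
  must end at \<open>w\<close>, the only value not taken. So \<open>w\<close> reaches everything, and the arc from
  \<open>j\<close> to \<open>w\<close> turns the path into a cycle.
\<close>

lemma cyclic_close_path:
  fixes \<sigma> :: "'a::finite \<Rightarrow> 'a"
  assumes inj: "inj_on \<sigma> (- {j})" and acyc: "acyclic (arcs (- {j}) \<sigma>)"
    and w: "w \<notin> \<sigma> ` (- {j})"
  shows "\<sigma>(j := w) permutes UNIV" "cyclic_on (\<sigma>(j := w)) UNIV"
proof -
  let ?R = "arcs (- {j}) \<sigma>" and ?\<tau> = "\<sigma>(j := w)"
  have "inj ?\<tau>"
    using inj w unfolding inj_on_def by (metis (no_types) ComplI fun_upd_apply imageI singletonD UNIV_I)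
  then have "bij ?\<tau>"
    unfolding bij_def by (metis finite_UNIV_inj_surj finite)
  then show "?\<tau> permutes UNIV"
    by (rule bij_imp_permutes) simp
  have R: "?R \<subseteq> arcs UNIV ?\<tau>"
    by (auto simp: arcs_def)
  have range: "\<sigma> ` (- {j}) = - {w}"
  proof (rule card_subset_eq)
    show "\<sigma> ` (- {j}) \<subseteq> - {w}" using w by auto
    show "card (\<sigma> ` (- {j})) = card (- {w})"
      using card_image[OF inj] by (simp add: card_complement)
  qed simp
  have "wf ?R"
    by (rule finite_acyclic_wf[OF finite_arcs acyc])
  then have from_w: "(w, x) \<in> ?R\<^sup>*" for x
  proof (induction x rule: wf_induct_rule)
    case (less x)
    show ?case
    proof (cases "x = w")
      case False
      then have "x \<in> \<sigma> ` (- {j})" using range by auto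
      then obtain y where "(y, x) \<in> ?R" by (auto simp: arcs_def)
      with less show ?thesis by (meson rtrancl.rtrancl_into_rtrancl)
    qed simp
  qed
  have "(j, w) \<in> arcs UNIV ?\<tau>"
    by (auto simp: arcs_def)
  then have "(j, x) \<in> (arcs UNIV ?\<tau>)\<^sup>+" for x
    using from_w[of x] rtrancl_mono[OF R] by (meson rtrancl_into_trancl2 subsetD)
  then have "orbit ?\<tau> j = UNIV"
    using arcs_trancl_orbit by fastforce
  then show "cyclic_on ?\<tau> UNIV"
    unfolding cyclic_on_def by blast
qed

text \<open>
  Arcs are added one at a time, keeping the map injective and acyclic, until only one point has no
  image; the last arc necessarily closes the cycle.
\<close>

lemma extend_to_full_cycle:
  fixes \<sigma> :: "'a::finite \<Rightarrow> 'a"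
  assumes "J \<noteq> UNIV" "inj_on \<sigma> J" "acyclic (arcs J \<sigma>)"
  shows "\<exists>\<tau>. (\<forall>j\<in>J. \<tau> j = \<sigma> j) \<and> \<tau> permutes UNIV \<and> cyclic_on \<tau> UNIV"
  using assms
proof (induction "card (- J)" arbitrary: J \<sigma> rule: less_induct)
  case less
  obtain j where j: "j \<notin> J" using less.prems by blast
  show ?case
  proof (cases "- J = {j}")
    case True
    then have J: "J = - {j}" by auto
    have "card (\<sigma> ` J) = card J" by (rule card_image) fact
    also have "\<dots> < CARD('a)"
      using less.prems(1) by (simp add: psubset_card_mono psubsetI)
    finally have "\<sigma> ` J \<noteq> UNIV" by auto
    then obtain w where "w \<notin> \<sigma> ` J" by blast
    with less.prems J have "\<sigma>(j := w) permutes UNIV" "cyclic_on (\<sigma>(j := w)) UNIV"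
      by (metis cyclic_close_path)+
    with j show ?thesis by (intro exI[of _ "\<sigma>(j := w)"]) auto
  next
    case False
    then obtain j' where j': "j' \<notin> J" "j' \<noteq> j" using j by blast
    then have "card {j, j'} \<le> card (- J)"
      using j by (intro card_mono) auto
    with j' have "card J + 2 \<le> CARD('a)"
      by (simp add: card_complement)
    with less.prems obtain w where w: "w \<notin> \<sigma> ` J" "(w, j) \<notin> (arcs J \<sigma>)\<^sup>*"
      by (metis ex_source_not_reaching)
    let ?\<sigma> = "\<sigma>(j := w)"
    have "\<exists>\<tau>. (\<forall>i\<in>insert j J. \<tau> i = ?\<sigma> i) \<and> \<tau> permutes UNIV \<and> cyclic_on \<tau> UNIV"
    proof (rule less.hyps)
      have "- insert j J \<subset> - J" using j by auto
      then show "card (- insert j J) < card (- J)"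
        by (intro psubset_card_mono) auto
      show "insert j J \<noteq> UNIV" using j' by auto
      show "inj_on ?\<sigma> (insert j J)"
        using less.prems(2) w(1) j by (auto simp: inj_on_def)
      show "acyclic (arcs (insert j J) ?\<sigma>)"
        using less.prems(3) w(2) by (simp add: arcs_insert_upd[OF j])
    qed
    with j show ?thesis by (metis fun_upd_other insertCI)
  qed
qed

section \<open>Circuits and their partial circuits\<close>

definition coord_restrict :: "'n::finite set \<Rightarrow> real ^ 'n \<Rightarrow> real ^ 'n" where
  "coord_restrict J x = (\<chi> i. if i \<in> J then x $ i else 0)"

lemma coord_restrict_nth: "coord_restrict J x $ i = (if i \<in> J then x $ i else 0)"
  by (simp add: coord_restrict_def)

lemma linear_coord_restrict: "linear (coord_restrict J)"
  by (rule linearI) (auto simp: coord_restrict_def vec_eq_iff)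

text \<open>
  A closed walk along the arcs may repeat points, whereas \<open>creates_cycle\<close> asks for distinct ones;
  the shortest return to the starting point has no repetition.
\<close>

lemma closed_walk_creates_cycle:
  assumes x: "\<forall>j\<in>J. x $ j = v (\<sigma> j)" and cyc: "\<not> acyclic (arcs J \<sigma>)"
  shows "creates_cycle v J x"
proof -
  \<comment> \<open>From any point there is only one walk of a given length, namely iteration of \<open>\<sigma>\<close>.\<close>
  have walk: "(\<sigma> ^^ n) y = z \<and> (\<forall>t<n. (\<sigma> ^^ t) y \<in> J)" if "(y, z) \<in> arcs J \<sigma> ^^ n" for y z n
    using that
  proof (induction n arbitrary: z)
    case (Suc n)
    then show ?case by (auto simp: arcs_def less_Suc_eq)
  qed auto
  obtain y n0 where "n0 > 0" "(y, y) \<in> arcs J \<sigma> ^^ n0"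
    using cyc by (auto simp: acyclic_def trancl_power)
  define n where "n = (LEAST n. n > 0 \<and> (\<sigma> ^^ n) y = y)"
  have ex: "n0 > 0 \<and> (\<sigma> ^^ n0) y = y"
    using walk \<open>n0 > 0\<close> \<open>(y, y) \<in> arcs J \<sigma> ^^ n0\<close> by blast
  have n: "n > 0" "(\<sigma> ^^ n) y = y"
    using LeastI[of "\<lambda>n. n > 0 \<and> (\<sigma> ^^ n) y = y", OF ex] by (auto simp: n_def)
  have "n \<le> n0"
    unfolding n_def by (rule Least_le[of "\<lambda>n. n > 0 \<and> (\<sigma> ^^ n) y = y", OF ex])
  then have inJ: "(\<sigma> ^^ t) y \<in> J" if "t < n" for t
    using walk \<open>(y, y) \<in> arcs J \<sigma> ^^ n0\<close> that by fastforce
  have inj0: "inj_on (\<lambda>k. (\<sigma> ^^ k) y) {0..<n}"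
  proof (rule inj_on_funpow_least[OF n(2)])
    show "(\<sigma> ^^ m) y \<noteq> y" if "0 < m" "m < n" for m
      using not_less_Least[of m "\<lambda>n. n > 0 \<and> (\<sigma> ^^ n) y = y"] that by (auto simp: n_def)
  qed
  \<comment> \<open>Cycles are numbered from 1, iterates of \<open>\<sigma>\<close> from 0.\<close>
  have inj: "inj_on (\<lambda>t. (\<sigma> ^^ (t - 1)) y) {1..n}"
  proof -
    have "inj_on (\<lambda>t. t - 1) {1..n}" "(\<lambda>t. t - 1) ` {1..n} \<subseteq> {0..<n}"
      by (auto simp: inj_on_def)
    from comp_inj_on[OF this(1) inj_on_subset[OF inj0 this(2)]]
    show ?thesis by (simp add: o_def)
  qed
  show ?thesis
    unfolding creates_cycle_def
  proof (intro exI[of _ n] exI[of _ "\<lambda>t. (\<sigma> ^^ (t - 1)) y"] conjI inj ballI)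
    show "(\<lambda>t. (\<sigma> ^^ (t - 1)) y) ` {1..n} \<subseteq> J"
      using inJ by auto
    show "x $ (\<sigma> ^^ (t - 1)) y = v ((\<sigma> ^^ (t + 1 - 1)) y)" if "t \<in> {1..<n}" for t
      using x inJ[of "t - 1"] that by (cases t) auto
    show "x $ (\<sigma> ^^ (n - 1)) y = v ((\<sigma> ^^ (1 - 1)) y)"
      using x inJ[of "n - 1"] n by (cases n) auto
  qed (use n in auto)
qed

lemma J_circuit_extends_to_circuit:
  assumes inj_v: "inj v" and "J \<noteq> UNIV" and x: "J_circuit v J x"
  obtains y where "circuit v y" "coord_restrict J y = x"
proof -
  define \<sigma> where "\<sigma> j = inv v (x $ j)" for j
  have \<sigma>: "\<forall>j\<in>J. x $ j = v (\<sigma> j)"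
    using x by (auto simp: J_circuit_def \<sigma>_def f_inv_into_f)
  have "inj_on \<sigma> J"
    using x \<sigma> by (auto simp: J_circuit_def inj_on_def)
  moreover have "acyclic (arcs J \<sigma>)"
    using x closed_walk_creates_cycle[of J x v \<sigma>] \<sigma> by (auto simp: J_circuit_def)
  ultimately obtain \<tau> where \<tau>: "\<forall>j\<in>J. \<tau> j = \<sigma> j" "\<tau> permutes UNIV" "cyclic_on \<tau> UNIV"
    using extend_to_full_cycle[OF \<open>J \<noteq> UNIV\<close>] by blast
  show thesis
  proof
    show "circuit v (\<chi> i. v (\<tau> i))"
      using \<tau> unfolding circuit_def by auto
    show "coord_restrict J (\<chi> i. v (\<tau> i)) = x"
      using \<tau>(1) \<sigma> x by (auto simp: vec_eq_iff coord_restrict_nth J_circuit_def J_tuple_def)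
  qed
qed

text \<open>
  The points of a cycle inside \<open>J\<close> form a set closed under the permutation. As the orbit of each of
  its points is everything, this forces \<open>J\<close> to contain every index.
\<close>

lemma circuit_restricts_to_J_circuit:
  assumes inj_v: "inj v" and "J \<noteq> UNIV" and x: "circuit v x"
  shows "J_circuit v J (coord_restrict J x)"
proof -
  obtain \<sigma> where \<sigma>: "\<And>i. x $ i = v (\<sigma> i)" "\<sigma> permutes UNIV" "cyclic_on \<sigma> UNIV"
    using x by (auto simp: circuit_def)
  have "\<not> creates_cycle v J (coord_restrict J x)"
  proof
    assume "creates_cycle v J (coord_restrict J x)"
    then obtain k and i :: "nat \<Rightarrow> 'a" where k: "k \<ge> 1" and iJ: "i ` {1..k} \<subseteq> J"
      and step: "\<forall>t\<in>{1..<k}. coord_restrict J x $ i t = v (i (t + 1))"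
      and last: "coord_restrict J x $ i k = v (i 1)"
      unfolding creates_cycle_def by blast
    have closed: "\<sigma> y \<in> i ` {1..k}" if y: "y \<in> i ` {1..k}" for y
    proof -
      obtain t where t: "t \<in> {1..k}" "y = i t" using y by blast
      have "y \<in> J" using iJ y by blast
      show ?thesis
      proof (cases "t = k")
        case True
        then have "v (\<sigma> y) = v (i 1)"
          using last \<open>y \<in> J\<close> t \<sigma>(1) by (simp add: coord_restrict_nth)
        then have "\<sigma> y = i 1" using inj_v by (simp add: inj_eq)
        then show ?thesis using k by auto
      next
        case False
        then have "v (\<sigma> y) = v (i (t + 1))"
          using step[rule_format, of t] \<open>y \<in> J\<close> t \<sigma>(1)[of y] by (auto simp: coord_restrict_nth)
        then have "\<sigma> y = i (t + 1)" using inj_v by (simp add: inj_eq)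
        then show ?thesis using t False by auto
      qed
    qed
    have i1: "i 1 \<in> i ` {1..k}" using k by auto
    have "orbit \<sigma> (i 1) = UNIV"
      using \<sigma>(3) by (auto simp: cyclic_on_alldef)
    moreover have "y \<in> i ` {1..k}" if "y \<in> orbit \<sigma> (i 1)" for y
      using that by induction (use closed i1 in auto)
    ultimately show False using iJ \<open>J \<noteq> UNIV\<close> by blast
  qed
  moreover have "inj_on (\<lambda>j. coord_restrict J x $ j) J"
  proof (rule inj_onI)
    fix i j assume "i \<in> J" "j \<in> J" "coord_restrict J x $ i = coord_restrict J x $ j"
    then have "v (\<sigma> i) = v (\<sigma> j)" by (simp add: coord_restrict_nth \<sigma>(1))
    then show "i = j"
      using inj_v permutes_inj[OF \<sigma>(2)] by (blast dest: injD)
  qed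
  ultimately show ?thesis
    by (auto simp: J_circuit_def J_tuple_def coord_restrict_nth \<sigma>(1))
qed

section \<open>The dimension of the hamiltonian circuit polytope\<close>

lemma circuit_sum:
  assumes "circuit v x"
  shows "(\<Sum>i\<in>UNIV. x $ i) = (\<Sum>i\<in>UNIV. v i)"
proof -
  obtain \<sigma> where "\<And>i. x $ i = v (\<sigma> i)" "\<sigma> permutes UNIV"
    using assms by (auto simp: circuit_def)
  then show ?thesis by (simp add: sum.permute[of \<sigma> UNIV v] o_def)
qed

lemma cyclic_conj:
  assumes "cyclic_on \<sigma> UNIV" "bij t"
  shows "cyclic_on (t \<circ> \<sigma> \<circ> inv t) UNIV"
proof -
  have "cyclic_on (t \<circ> \<sigma> \<circ> inv t) (t ` UNIV)"
    by (rule cyclic_on_image[OF assms(1)]) (simp add: bij_is_inj[OF assms(2)])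
  then show ?thesis using assms(2) by (simp add: bij_is_surj)
qed

lemma ex_cycle_through_path:
  fixes i k a b :: "'n::finite"
  assumes "distinct [i, k, a, b]"
  obtains \<sigma> where "\<sigma> permutes UNIV" "cyclic_on \<sigma> UNIV" "\<sigma> i = k" "\<sigma> k = a" "\<sigma> a = b"
proof -
  let ?f = "id(i := k, k := a, a := b)"
  have arcs: "arcs {i, k, a} ?f = {(i, k), (k, a), (a, b)}"
    using assms by (auto simp: arcs_def)
  have "{(i, k), (k, a), (a, b)} \<subseteq> inv_image less_than (\<lambda>z. if z = i then 0 else if z = k then 1 else if z = a then 2 else (3 :: nat))"
    using assms by auto
  then have "acyclic (arcs {i, k, a} ?f)"
    unfolding arcs by (rule acyclic_subset[OF wf_acyclic[OF wf_inv_image[OF wf_less_than]]])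
  moreover have "{i, k, a} \<noteq> UNIV"
    using assms by (metis UNIV_I distinct_length_2_or_more empty_iff insert_iff)
  moreover have "inj_on ?f {i, k, a}"
    using assms by simp
  ultimately have "\<exists>\<tau>. (\<forall>j\<in>{i, k, a}. \<tau> j = ?f j) \<and> \<tau> permutes UNIV \<and> cyclic_on \<tau> UNIV"
    by (intro extend_to_full_cycle)
  then show thesis using that assms by force
qed

text \<open>
  Conjugating a full cycle through \<open>i \<rightarrow> k \<rightarrow> a \<rightarrow> b\<close> by the transposition of \<open>k\<close> and \<open>a\<close> gives the full
  cycle through \<open>i \<rightarrow> a \<rightarrow> k \<rightarrow> b\<close> that agrees with it elsewhere. Comparing a functional at these two
  circuits leaves only the terms at \<open>i\<close>, \<open>k\<close> and \<open>a\<close>.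
\<close>

lemma exchange_equation:
  fixes c :: "real ^ 'n::finite"
  assumes const: "\<And>x. circuit v x \<Longrightarrow> c \<bullet> x = d" and dist: "distinct [i, k, a, b]"
  shows "(c $ i - c $ a) * v k + (c $ k - c $ i) * v a + (c $ a - c $ k) * v b = 0"
proof -
  obtain \<sigma> where \<sigma>: "\<sigma> permutes UNIV" "cyclic_on \<sigma> UNIV" "\<sigma> i = k" "\<sigma> k = a" "\<sigma> a = b"
    using ex_cycle_through_path[OF dist] .
  define t where "t = Transposition.transpose k a"
  define \<sigma>' where "\<sigma>' = t \<circ> \<sigma> \<circ> t"
  have t: "bij t" "inv t = t" by (simp_all add: t_def)
  have "cyclic_on \<sigma>' UNIV" unfolding \<sigma>'_def using cyclic_conj[OF \<sigma>(2) t(1)] t(2) by simp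
  moreover have "\<sigma>' permutes UNIV"
    unfolding \<sigma>'_def using permutes_bij[OF \<sigma>(1)] t(1) by (intro bij_imp_permutes) (auto intro: bij_comp)
  ultimately have "c \<bullet> (\<chi> j. v (\<sigma>' j)) = d" "c \<bullet> (\<chi> j. v (\<sigma> j)) = d"
    using \<sigma> by (auto intro!: const simp: circuit_def)
  then have "(\<Sum>j\<in>UNIV. c $ j * (v (\<sigma> j) - v (\<sigma>' j))) = 0"
    by (simp add: inner_vec_def right_diff_distrib sum_subtractf)
  also have "(\<Sum>j\<in>UNIV. c $ j * (v (\<sigma> j) - v (\<sigma>' j))) = (\<Sum>j\<in>{i, k, a}. c $ j * (v (\<sigma> j) - v (\<sigma>' j)))"
  proof (rule sum.mono_neutral_right)
    have "\<sigma>' j = \<sigma> j" if "j \<notin> {i, k, a}" for j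
    proof -
      have "\<sigma> j \<noteq> k" "\<sigma> j \<noteq> a"
        using that \<sigma>(3,4) permutes_inj[OF \<sigma>(1)] by (metis injD insertCI)+
      then show ?thesis using that by (simp add: \<sigma>'_def t_def Transposition.transpose_def)
    qed
    then show "\<forall>j\<in>UNIV - {i, k, a}. c $ j * (v (\<sigma> j) - v (\<sigma>' j)) = 0" by auto
  qed auto
  also have "\<dots> = c $ i * (v k - v a) + c $ k * (v a - v b) + c $ a * (v b - v k)"
    using dist \<sigma>(3-5) by (auto simp: \<sigma>'_def t_def Transposition.transpose_def)
  finally show ?thesis by (simp add: algebra_simps)
qed

text \<open>
  In the exchange equation \<open>b\<close> occurs only in \<open>(c\<^sub>a - c\<^sub>k) v\<^sub>b\<close>. A fifth index \<open>b'\<close> allows \<open>b\<close> to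
  vary while \<open>i\<close>, \<open>k\<close>, \<open>a\<close> stay fixed, which forces \<open>c\<^sub>a = c\<^sub>k\<close>.
\<close>

lemma constant_on_circuits_imp_constant_coeffs:
  fixes c :: "real ^ 'n::finite"
  assumes "inj v" "5 \<le> CARD('n)" and const: "\<And>x. circuit v x \<Longrightarrow> c \<bullet> x = d"
  shows "c $ k = c $ a"
proof (cases "k = a")
  case False
  then have "3 \<le> card (- {k, a})"
    using assms(2) by (simp add: card_complement)
  then obtain T where T: "T \<subseteq> - {k, a}" "card T = 3"
    by (meson obtain_subset_with_card_n)
  then obtain i b b' where "T = {i, b, b'}" "i \<noteq> b" "i \<noteq> b'" "b \<noteq> b'"
    by (auto simp: card_3_iff)
  then have "distinct [i, k, a, b]" "distinct [i, k, a, b']" and "b \<noteq> b'"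
    using T False by auto
  then have "(c $ i - c $ a) * v k + (c $ k - c $ i) * v a + (c $ a - c $ k) * v b = 0"
    "(c $ i - c $ a) * v k + (c $ k - c $ i) * v a + (c $ a - c $ k) * v b' = 0"
    using exchange_equation[of v c d] const by blast+
  then have "(c $ a - c $ k) * (v b - v b') = 0"
    unfolding right_diff_distrib by linarith
  then show ?thesis using \<open>inj v\<close> \<open>b \<noteq> b'\<close> by (simp add: inj_eq)
qed simp

text \<open>
  If the dimension were smaller, the directions between circuits together with the all-ones vector
  would still not span the space, and some nonzero \<open>c\<close> would be orthogonal to all of them. Then \<open>c\<close> is
  constant on circuits, so its coefficients are equal, and being orthogonal to the
  all-ones vector makes it zero.
\<close>

lemma aff_dim_circuits_ge:
  fixes v :: "'n::finite \<Rightarrow> real"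
  assumes "inj v" "5 \<le> CARD('n)"
  shows "aff_dim {x. circuit v x} \<ge> int CARD('n) - 1"
proof (rule ccontr)
  assume small: "\<not> ?thesis"
  obtain \<tau> :: "'n \<Rightarrow> 'n" where "\<tau> permutes UNIV" "cyclic_on \<tau> UNIV"
    using extend_to_full_cycle[of "{}" id] by (auto simp: arcs_def wf_acyclic)
  then have x0: "circuit v (\<chi> i. v (\<tau> i))" (is "circuit v ?x0") by (auto simp: circuit_def)
  let ?D = "(\<lambda>x. x - ?x0) ` {x. circuit v x}"
  let ?one = "\<chi> i. 1 :: real ^ 'n"
  have "aff_dim {x. circuit v x} = int (dim ?D)"
    by (rule aff_dim_eq_dim_subtract) (use x0 in \<open>auto intro: hull_inc\<close>)
  then have "dim (insert ?one ?D) < DIM(real ^ 'n)"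
    using small by (auto simp: dim_insert)
  then obtain c where c: "c \<noteq> 0" "\<And>y. y \<in> span (insert ?one ?D) \<Longrightarrow> orthogonal c y"
    by (metis orthogonal_to_subspace_exists)
  have const: "c \<bullet> x = c \<bullet> ?x0" if "circuit v x" for x
    using c(2)[of "x - ?x0"] that
    by (auto simp: orthogonal_def inner_diff_right intro!: span_base)
  have eq: "c $ j = c $ i" for i j
    by (rule constant_on_circuits_imp_constant_coeffs[OF assms const])
  have "0 = c \<bullet> ?one"
    using c(2)[of ?one] by (auto simp: orthogonal_def intro!: span_base)
  also have "\<dots> = (\<Sum>i\<in>UNIV. c $ i)" by (simp add: inner_vec_def)
  also have "\<dots> = real CARD('n) * c $ j" for j by (subst eq[of _ j]) simp
  finally have "c = 0" by (simp add: vec_eq_iff)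
  with c(1) show False by simp
qed

section \<open>Projecting the facet to a set of coordinates\<close>

text \<open>
  The directions of \<open>C\<close> lie in the span of their restrictions to \<open>J\<close> and the unit vectors outside \<open>J\<close>.
  This bounds the dimension lost by \<open>card (- J)\<close>. The bound improves by one because the directions
  have coordinate sum 0: a unit vector outside \<open>J\<close> is in that span, but is not a combination of
  directions.
\<close>

lemma aff_dim_coord_restrict_ge:
  fixes C :: "(real ^ 'n::finite) set"
  assumes sum: "\<And>x. x \<in> C \<Longrightarrow> (\<Sum>i\<in>UNIV. x $ i) = s" and "J \<noteq> UNIV" "C \<noteq> {}"
  shows "aff_dim C + card J + 1 \<le> aff_dim (coord_restrict J ` C) + CARD('n)"
proof -
  obtain x0 where x0: "x0 \<in> C" using \<open>C \<noteq> {}\<close> by blast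
  obtain i0 where i0: "i0 \<notin> J" using \<open>J \<noteq> UNIV\<close> by blast
  let ?p = "coord_restrict J"
  let ?D = "(\<lambda>x. x - x0) ` C"
  let ?A = "(\<lambda>i. axis i 1 :: real ^ 'n) ` (- J)"
  have dimC: "aff_dim C = int (dim ?D)"
    by (rule aff_dim_eq_dim_subtract) (use x0 in \<open>auto intro: hull_inc\<close>)
  have "aff_dim (?p ` C) = int (dim ((\<lambda>x. x - ?p x0) ` ?p ` C))"
    by (rule aff_dim_eq_dim_subtract) (use x0 in \<open>auto intro: hull_inc\<close>)
  also have "(\<lambda>x. x - ?p x0) ` ?p ` C = ?p ` ?D"
    by (simp add: image_image linear_diff[OF linear_coord_restrict])
  finally have dimpC: "aff_dim (?p ` C) = int (dim (?p ` ?D))" .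
  obtain B where B: "B \<subseteq> ?p ` ?D" "independent B" "?p ` ?D \<subseteq> span B" "card B = dim (?p ` ?D)"
    by (metis basis_exists)
  have "finite B" using B(2) by (rule independent_imp_finite)
  have "?D \<subseteq> span (B \<union> ?A)"
  proof
    fix y assume y: "y \<in> ?D"
    have "y = ?p y + (\<Sum>i\<in>- J. y $ i *\<^sub>R axis i 1)"
      by (auto simp: vec_eq_iff coord_restrict_nth axis_def if_distrib cong: if_cong)
    moreover have "?p y \<in> span (B \<union> ?A)"
      using B(3) y span_mono[of B "B \<union> ?A"] by auto
    moreover have "(\<Sum>i\<in>- J. y $ i *\<^sub>R axis i 1) \<in> span (B \<union> ?A)"
      by (intro span_sum span_scale span_base) auto
    ultimately show "y \<in> span (B \<union> ?A)" by (metis span_add)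
  qed
  moreover have "axis i0 1 \<in> span (B \<union> ?A)"
    using i0 by (intro span_base) auto
  ultimately have "dim (insert (axis i0 1) ?D) \<le> card (B \<union> ?A)"
    using \<open>finite B\<close> by (intro dim_le_card) auto
  also have "\<dots> \<le> card B + card ?A" by (rule card_Un_le)
  also have "\<dots> \<le> dim (?p ` ?D) + card (- J)"
    using B(4) by (simp add: card_image_le)
  finally have "dim (insert (axis i0 1) ?D) \<le> dim (?p ` ?D) + card (- J)" .
  moreover have "dim (insert (axis i0 1) ?D) = dim ?D + 1"
  proof -
    have "span ?D \<subseteq> {y. (\<Sum>i\<in>UNIV. y $ i) = 0}"
    proof (rule span_minimal)
      show "?D \<subseteq> {y. (\<Sum>i\<in>UNIV. y $ i) = 0}"
        using sum x0 by (auto simp: sum_subtractf)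
      show "subspace {y :: real ^ 'n. (\<Sum>i\<in>UNIV. y $ i) = 0}"
        by (auto simp: subspace_def sum.distrib simp flip: sum_distrib_left)
    qed
    moreover have "(\<Sum>i\<in>UNIV. (axis i0 1 :: real ^ 'n) $ i) = 1"
      by (simp add: axis_def)
    ultimately have "axis i0 1 \<notin> span ?D" by auto
    then show ?thesis by (simp add: dim_insert)
  qed
  moreover have "card (- J) + card J = CARD('n)"
    by (simp add: card_complement card_mono)
  ultimately show ?thesis using dimC dimpC by linarith
qed

lemma finite_circuits: "finite {x. circuit v x}"
proof (rule finite_subset)
  show "{x. circuit v x} \<subseteq> range (\<lambda>\<sigma>. \<chi> i. v (\<sigma> i))"
    by (auto simp: circuit_def vec_eq_iff image_iff)
qed simp

text \<open>
  A face of the hull of finitely many points is the hull of some of these points, so the facet is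
  spanned by the circuits on it.
\<close>

lemma facet_circuits:
  assumes "facet_defining (hamiltonian_circuit_polytope v) f \<alpha>"
  obtains C where "\<And>x. x \<in> C \<Longrightarrow> circuit v x \<and> f x = \<alpha>"
    "aff_dim C = aff_dim {x. circuit v x} - 1"
proof -
  let ?P = "hamiltonian_circuit_polytope v"
  have face: "{x \<in> ?P. f x = \<alpha>} face_of convex hull {x. circuit v x}"
    and dim: "aff_dim {x \<in> ?P. f x = \<alpha>} = aff_dim ?P - 1"
    using assms by (auto simp: facet_defining_def hamiltonian_circuit_polytope_def)
  obtain C where C: "C \<subseteq> {x. circuit v x}" "{x \<in> ?P. f x = \<alpha>} = convex hull C"
    using face_of_convex_hull_subset[OF finite_imp_compact[OF finite_circuits] face] .
  show thesis
  proof
    show "circuit v x \<and> f x = \<alpha>" if "x \<in> C" for x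
      using that C hull_inc[of x C convex] by auto
    show "aff_dim C = aff_dim {x. circuit v x} - 1"
      using dim C(2) by (simp add: aff_dim_convex_hull hamiltonian_circuit_polytope_def)
  qed
qed

theorem theorem7:
  fixes v :: "'n::{finite,linorder} \<Rightarrow> real"
    and J :: "'n set"
    and a :: "'n \<Rightarrow> real"
    and \<alpha> :: real
  assumes "\<And>i. 0 \<le> v i"
    and "strict_mono v"
    and "card J + 4 \<le> CARD('n)"
    and "\<And>j. j \<in> J \<Longrightarrow> a j \<noteq> 0"
    and "facet_defining (hamiltonian_circuit_polytope v) (\<lambda>x. \<Sum>j\<in>J. a j * x $ j) \<alpha>"
  shows "(\<forall>x. undominated_J_circuit v J {j \<in> J. a j > 0} {j \<in> J. a j < 0} x
              \<longrightarrow> (\<Sum>j\<in>J. a j * x $ j) \<ge> \<alpha>) \<and>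
         (\<exists>S. finite S \<and> card S \<ge> card J \<and> \<not> affine_dependent S \<and>
              (\<forall>x\<in>S. J_circuit v J x \<and> (\<Sum>j\<in>J. a j * x $ j) = \<alpha>))"
proof
  let ?f = "\<lambda>x. \<Sum>j\<in>J. a j * x $ j"
  have inj: "inj v"
    using \<open>strict_mono v\<close> by (rule strict_mono_imp_inj_on)
  have J: "J \<noteq> UNIV"
    using \<open>card J + 4 \<le> CARD('n)\<close> by auto
  have f_restrict: "?f (coord_restrict J y) = ?f y" for y
    by (simp add: coord_restrict_nth)
  show "\<forall>x. undominated_J_circuit v J {j \<in> J. a j > 0} {j \<in> J. a j < 0} x \<longrightarrow> ?f x \<ge> \<alpha>"
  proof (intro allI impI)
    fix x assume "undominated_J_circuit v J {j \<in> J. a j > 0} {j \<in> J. a j < 0} x"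
    then have "J_circuit v J x" by (simp add: undominated_J_circuit_def)
    then obtain y where y: "circuit v y" "coord_restrict J y = x"
      using J_circuit_extends_to_circuit[OF inj J] by blast
    then have "y \<in> hamiltonian_circuit_polytope v"
      by (simp add: hamiltonian_circuit_polytope_def hull_inc)
    then have "?f y \<ge> \<alpha>"
      using assms(5) by (simp add: facet_defining_def)
    then show "?f x \<ge> \<alpha>"
      using f_restrict[of y] y(2) by simp
  qed
  show "\<exists>S. finite S \<and> card S \<ge> card J \<and> \<not> affine_dependent S \<and>
          (\<forall>x\<in>S. J_circuit v J x \<and> ?f x = \<alpha>)"
  proof (cases "J = {}")
    case True
    then show ?thesis by (intro exI[of _ "{}"]) auto
  next
    case False
    then have "card J \<ge> 1" by (simp add: Suc_le_eq card_gt_0_iff)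
    then have n: "5 \<le> CARD('n)" using assms(3) by linarith
    obtain C where C: "\<And>x. x \<in> C \<Longrightarrow> circuit v x \<and> ?f x = \<alpha>"
        "aff_dim C = aff_dim {x. circuit v x} - 1"
      using facet_circuits[OF assms(5)] by blast
    have dimC: "aff_dim C \<ge> int CARD('n) - 2"
      using aff_dim_circuits_ge[OF inj n] C(2) by linarith
    then have "C \<noteq> {}" using n by auto
    have "aff_dim C + card J + 1 \<le> aff_dim (coord_restrict J ` C) + CARD('n)"
      using C(1) circuit_sum by (intro aff_dim_coord_restrict_ge[OF _ J \<open>C \<noteq> {}\<close>]) blast
    then have dim: "aff_dim (coord_restrict J ` C) \<ge> int (card J) - 1"
      using dimC by linarith
    obtain S where S: "S \<subseteq> coord_restrict J ` C" "\<not> affine_dependent S"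
        "affine hull (coord_restrict J ` C) = affine hull S"
      using affine_basis_exists by blast
    have "int (card S) = aff_dim (coord_restrict J ` C) + 1"
      by (rule aff_dim_unique) (use S in auto)
    then have "card S \<ge> card J" using dim by linarith
    moreover have "finite S"
      using S(2) by (rule aff_independent_finite)
    moreover have "J_circuit v J x \<and> ?f x = \<alpha>" if xS: "x \<in> S" for x
    proof -
      obtain y where "y \<in> C" "x = coord_restrict J y" using xS S(1) by blast
      then show ?thesis
        using C(1)[of y] circuit_restricts_to_J_circuit[OF inj J] f_restrict by metis
    qed
    ultimately show ?thesis using S(2) by blast
  qed
qed

end
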